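(* Let $1\le q<3$ and let $Y$ be a real random variable following the standard (central) $q$-Gaussian distribution $N_q(0,1)$. Then the coefficient of normalized kurtosis of $Y$ is $$\overline{\mathrm{Kurt}}[Y]=\frac{\overline{E}(Y^4)}{(\overline{E}(Y^2))^2}=\frac{3(q+1)^2}{(5q-3)(3q-1)} .$$
   Context: For real $q$ and $u$, the $q$-exponential is $e_q^{u}=e_q(u)=[1+(1-q)u]_+^{1/(1-q)}$ for $q\ne 1$, and $e_1^{u}=\exp(u)$. For $1\le q<3$ put $\beta=\frac{1}{3-q}$ and $C_q=\int_{-\infty}^{\infty}e_q^{-x^2}\,dx$, so that $C_1=\sqrt{\pi}$ and $C_q=\left(\frac{1}{q-1}\right)^{1/2}B\!\left(\frac{3-q}{2(q-1)},\frac12\right)$ for $1<q<3$, where $B$ is the beta function. The standard $q$-Gaussian distribution $N_q(0,1)$ has density $f(y)=\frac{\sqrt{\beta}}{C_q}e_q^{-\beta y^2}$, $y\in\mathbb{R}$. For real $r$, $\nu_r(f)=\int_{-\infty}^{+\infty}[f(y)]^r\,dy$. The normalized moments are taken with respect to escort densities: the normalized second moment uses order $2q-1$ and the normalized fourth moment uses order $4q-3$, i.e. $$\overline{E}(Y^2)=\int_{-\infty}^{+\infty}y^2\,\frac{[f(y)]^{2q-1}}{\nu_{2q-1}(f)}\,dy,\qquad \overline{E}(Y^4)=\int_{-\infty}^{+\infty}y^4\,\frac{[f(y)]^{4q-3}}{\nu_{4q-3}(f)}\,dy .$$ *)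

theory Defs
  imports "HOL-Probability.Probability"
begin

text \<open>For \<open>q > 1\<close> and \<open>1 + (1 - q) * u \<le> 0\<close> the exponent is negative and the value is
  \<open>0 powr _ = 0\<close> by the library convention; this case does not arise for the arguments \<open>u \<le> 0\<close>
  used below.\<close>

definition q_exp :: "real \<Rightarrow> real \<Rightarrow> real" where
  "q_exp q u = (if q = 1 then exp u else (max 0 (1 + (1 - q) * u)) powr (1 / (1 - q)))"

definition q_beta :: "real \<Rightarrow> real" where
  "q_beta q = 1 / (3 - q)"

definition q_norm_const :: "real \<Rightarrow> real" where
  "q_norm_const q = (\<integral>x. q_exp q (- (x\<^sup>2)) \<partial>lborel)"

definition q_gaussian_density :: "real \<Rightarrow> real \<Rightarrow> real" where
  "q_gaussian_density q y = sqrt (q_beta q) / q_norm_const q * q_exp q (- (q_beta q * y\<^sup>2))"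

definition std_q_gaussian :: "real \<Rightarrow> 'a measure \<Rightarrow> ('a \<Rightarrow> real) \<Rightarrow> bool" where
  "std_q_gaussian q M Y \<longleftrightarrow> distributed M lborel Y (\<lambda>y. ennreal (q_gaussian_density q y))"

text \<open>A version of the Lebesgue density of the law of \<open>Y\<close>. It is determined only up to null sets,
  which does not affect the integrals below.\<close>

definition rv_density :: "'a measure \<Rightarrow> ('a \<Rightarrow> real) \<Rightarrow> real \<Rightarrow> real" where
  "rv_density M Y y = enn2real (RN_deriv lborel (distr M lborel Y) y)"

definition nu :: "real \<Rightarrow> (real \<Rightarrow> real) \<Rightarrow> real" where
  "nu r f = (\<integral>y. f y powr r \<partial>lborel)"

text \<open>The moment of \<open>Y\<close> of degree \<open>n\<close> with respect to the escort density of order \<open>r\<close>.\<close>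

definition escort_moment :: "real \<Rightarrow> nat \<Rightarrow> 'a measure \<Rightarrow> ('a \<Rightarrow> real) \<Rightarrow> real" where
  "escort_moment r n M Y =
    (\<integral>y. y ^ n * (rv_density M Y y powr r / nu r (rv_density M Y)) \<partial>lborel)"

definition normalized_second_moment :: "real \<Rightarrow> 'a measure \<Rightarrow> ('a \<Rightarrow> real) \<Rightarrow> real" where
  "normalized_second_moment q M Y = escort_moment (2 * q - 1) 2 M Y"

definition normalized_fourth_moment :: "real \<Rightarrow> 'a measure \<Rightarrow> ('a \<Rightarrow> real) \<Rightarrow> real" where
  "normalized_fourth_moment q M Y = escort_moment (4 * q - 3) 4 M Y"

definition normalized_kurtosis :: "real \<Rightarrow> 'a measure \<Rightarrow> ('a \<Rightarrow> real) \<Rightarrow> real" where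
  "normalized_kurtosis q M Y =
    normalized_fourth_moment q M Y / (normalized_second_moment q M Y)\<^sup>2"

end

theory Submission
  imports Defs "HOL-Real_Asymp.Real_Asymp"
begin

text \<open>
  Write \<open>w(y) = e\<^sub>q(- b y\<^sup>2)\<close> with \<open>b = 1 / (3 - q)\<close>. The density of \<open>Y\<close> is \<open>K w\<close> almost everywhere,
  for some constant \<open>K > 0\<close>. An escort density of order \<open>r\<close> is normalised, so \<open>K\<close> cancels, and the
  moments in question are the quotients \<open>J n / J 0\<close> of \<open>J n = \<integral> y\<^sup>n w\<^sup>r dy\<close>.

  These quotients follow from two identities that hold for the Gaussian case \<open>q = 1\<close> and for
  \<open>q > 1\<close> alike, so that neither exponential nor beta integrals have to be evaluated:
  \<open>w' = - 2 b y w\<^sup>q\<close> and \<open>w\<^bsup>1 - q\<^esup> = 1 + (q - 1) b y\<^sup>2\<close>. With them, the derivative of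
  \<open>y\<^bsup>k + 1\<^esup> w\<^bsup>r - q + 1\<^esup>\<close> is a combination of \<open>y\<^sup>k w\<^sup>r\<close> and \<open>y\<^bsup>k + 2\<^esup> w\<^sup>r\<close> with constant coefficients, and
  integrating it over the real line gives (\<open>q_kernel_moment_recurrence\<close>)
  \<open>(k + 1) J k = b (2 (r - q + 1) - (k + 1) (q - 1)) J (k + 2)\<close>.
  For \<open>r = 2 q - 1\<close> one step yields the second moment \<open>1 / (b (q + 1))\<close>; for \<open>r = 4 q - 3\<close> two
  steps yield the fourth moment \<open>3 / (b\<^sup>2 (5 q - 3) (3 q - 1))\<close>. In the kurtosis \<open>b\<close> cancels.

  The analytic work is the decay \<open>q_kernel_decay\<close>, which makes the integrals finite and the
  boundary terms vanish. The escort orders grow with \<open>q\<close> fast enough for this to hold for all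
  \<open>q \<ge> 1\<close>, although for \<open>q > 1\<close> the density itself has heavy tails.
\<close>

section \<open>Integrals over the real line\<close>

text \<open>The decay and continuity bound \<open>(1 + y\<^sup>2) g\<close>, so that a multiple of the Cauchy density dominates \<open>g\<close>.\<close>

lemma integrable_if_square_decay:
  fixes g :: "real \<Rightarrow> real"
  assumes cont: "continuous_on UNIV g"
    and decay: "((\<lambda>y. y\<^sup>2 * g y) \<longlongrightarrow> 0) at_infinity"
  shows "integrable lborel g"
proof -
  have "eventually (\<lambda>y. \<bar>y\<^sup>2 * g y\<bar> < 1) at_infinity"
    using tendstoD[OF decay, of 1] by simp
  then obtain N where N: "\<And>y. N \<le> \<bar>y\<bar> \<Longrightarrow> \<bar>y\<^sup>2 * g y\<bar> < 1"
    by (auto simp: eventually_at_infinity)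
  define R where "R = max N 1"
  have "compact ((\<lambda>y. (1 + y\<^sup>2) * g y) ` cball 0 R)"
    by (intro compact_continuous_image continuous_intros continuous_on_subset[OF cont]) auto
  then obtain B where B: "\<And>y. \<bar>y\<bar> \<le> R \<Longrightarrow> \<bar>(1 + y\<^sup>2) * g y\<bar> \<le> B"
    by (force dest!: compact_imp_bounded simp: bounded_iff)
  have bound: "\<bar>(1 + y\<^sup>2) * g y\<bar> \<le> max B 2" for y
  proof (cases "\<bar>y\<bar> \<le> R")
    case True
    then show ?thesis using B[OF True] by simp
  next
    case False
    then have "N \<le> \<bar>y\<bar>" "1 \<le> \<bar>y\<bar>" by (auto simp: R_def)
    then have "1 \<le> y\<^sup>2" using one_le_power[of "\<bar>y\<bar>" 2] by simp
    then have "(1 + y\<^sup>2) * \<bar>g y\<bar> \<le> (2 * y\<^sup>2) * \<bar>g y\<bar>"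
      by (intro mult_right_mono) auto
    also have "\<dots> \<le> 2"
      using N[OF \<open>N \<le> \<bar>y\<bar>\<close>] by (simp add: abs_mult)
    finally show ?thesis by (simp add: abs_mult)
  qed
  have "integrable lborel (\<lambda>y::real. max B 2 * inverse (1 + y\<^sup>2))"
    using integrable_inverse_1_plus_square
    by (simp add: set_integrable_def)
  then show ?thesis
  proof (rule Bochner_Integration.integrable_bound)
    show "g \<in> borel_measurable lborel"
      using borel_measurable_continuous_onI[OF cont] by simp
    show "AE y in lborel. norm (g y) \<le> norm (max B 2 * inverse (1 + y\<^sup>2))"
    proof (rule AE_I2)
      fix y :: real
      have pos: "0 < 1 + y\<^sup>2" by (simp add: add_pos_nonneg)
      have "\<bar>g y\<bar> \<le> max B 2 / (1 + y\<^sup>2)"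
        using bound[of y] pos by (simp add: field_simps abs_mult)
      then show "norm (g y) \<le> norm (max B 2 * inverse (1 + y\<^sup>2))"
        using pos by (simp add: divide_inverse)
    qed
  qed
qed

lemma integral_derivative_eq_0:
  fixes F f :: "real \<Rightarrow> real"
  assumes deriv: "\<And>y. (F has_real_derivative f y) (at y)"
    and cont: "continuous_on UNIV f"
    and int: "integrable lborel f"
    and vanish: "(F \<longlongrightarrow> 0) at_infinity"
  shows "(\<integral>y. f y \<partial>lborel) = 0"
proof -
  have "(LBINT y=-\<infinity>..\<infinity>. f y) = 0 - 0"
  proof (rule interval_integral_FTC_integrable)
    show "((F \<circ> real_of_ereal) \<longlongrightarrow> 0) (at_right (- \<infinity>))"
         "((F \<circ> real_of_ereal) \<longlongrightarrow> 0) (at_left \<infinity>)"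
      using filterlim_mono[OF vanish order_refl at_bot_le_at_infinity]
        filterlim_mono[OF vanish order_refl at_top_le_at_infinity]
      by (simp_all only: ereal_tendsto_simps)
    show "(F has_vector_derivative f y) (at y)" for y
      using deriv by (simp add: has_real_derivative_iff_has_vector_derivative)
    show "isCont f y" for y
      using cont by (simp add: continuous_on_eq_continuous_at)
    show "set_integrable lborel (einterval (- \<infinity>) \<infinity>) f"
      using int by (simp add: set_integrable_def)
  qed simp
  then show ?thesis
    by (simp add: interval_lebesgue_integral_def set_lebesgue_integral_def)
qed

section \<open>The kernel of the q-Gaussian density\<close>

definition q_kernel :: "real \<Rightarrow> real \<Rightarrow> real \<Rightarrow> real" where
  "q_kernel q b y = q_exp q (- (b * y\<^sup>2))"

lemma q_kernel_base_pos:
  fixes q b y :: real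
  assumes "1 \<le> q" "0 < b"
  shows "0 < 1 + (q - 1) * b * y\<^sup>2"
  using assms by (intro add_pos_nonneg) auto

lemma q_kernel_1: "q_kernel 1 b y = exp (- (b * y\<^sup>2))"
  by (simp add: q_kernel_def q_exp_def)

lemma q_kernel_gt_1:
  assumes "1 < q" "0 < b"
  shows "q_kernel q b y = (1 + (q - 1) * b * y\<^sup>2) powr (- 1 / (q - 1))"
proof -
  have "1 + (1 - q) * (- (b * y\<^sup>2)) = 1 + (q - 1) * b * y\<^sup>2" by (simp add: algebra_simps)
  moreover have "1 / (1 - q) = - 1 / (q - 1)" using assms by (simp add: field_simps)
  ultimately show ?thesis
    using assms q_kernel_base_pos[of q b y] unfolding q_kernel_def q_exp_def by simp
qed

lemma q_kernel_pos:
  assumes "1 \<le> q" "0 < b"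
  shows "0 < q_kernel q b y"
  using assms q_kernel_base_pos[OF assms, of y]
  by (cases "q = 1") (simp_all add: q_kernel_1 q_kernel_gt_1)

text \<open>Lowering the exponent by \<open>q - 1\<close> costs only a polynomial factor. This is what lets the integrals
  that arise from differentiation be rewritten as moments of a single order \<open>r\<close>.\<close>

lemma q_kernel_powr_shift:
  assumes "1 \<le> q" "0 < b"
  shows "q_kernel q b y powr (r - q + 1) = q_kernel q b y powr r * (1 + (q - 1) * b * y\<^sup>2)"
proof (cases "q = 1")
  case False
  then have exponent: "- ((1 - q) / (q - 1)) = 1" by (simp add: field_simps)
  have "q_kernel q b y powr (1 - q) = 1 + (q - 1) * b * y\<^sup>2"
    using False assms q_kernel_base_pos[OF assms, of y]
    by (simp add: q_kernel_gt_1 powr_powr exponent)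
  moreover have "q_kernel q b y powr (r - q + 1) = q_kernel q b y powr r * q_kernel q b y powr (1 - q)"
    by (simp flip: powr_add add: algebra_simps)
  ultimately show ?thesis by simp
qed simp

text \<open>The \<open>q\<close>-exponential solves \<open>e' = e\<^sup>q\<close>; the other factor comes from the chain rule.\<close>

lemma q_kernel_has_derivative:
  assumes "1 \<le> q" "0 < b"
  shows "(q_kernel q b has_real_derivative - (2 * b * y) * q_kernel q b y powr q) (at y)"
proof (cases "q = 1")
  case True
  then have "q_kernel q b = (\<lambda>y. exp (- (b * y\<^sup>2)))" by (auto simp: q_kernel_1)
  then show ?thesis using True by (auto intro!: derivative_eq_intros)
next
  case False
  then have q: "1 < q" using assms by simp
  let ?X = "1 + (q - 1) * b * y\<^sup>2"
  have X: "0 < ?X" using q_kernel_base_pos[OF assms] .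
  have eq: "q_kernel q b = (\<lambda>y. (1 + (q - 1) * b * y\<^sup>2) powr (- 1 / (q - 1)))"
    using q_kernel_gt_1[OF q assms(2)] by auto
  have "((\<lambda>y. (1 + (q - 1) * b * y\<^sup>2) powr (- 1 / (q - 1))) has_real_derivative
      (- 1 / (q - 1)) * ?X powr (- 1 / (q - 1) - 1) * ((q - 1) * b * (2 * y))) (at y)"
    using X by (auto intro!: derivative_eq_intros)
  then show ?thesis
    unfolding eq
  proof (rule DERIV_cong)
    have exponent: "- 1 / (q - 1) - 1 = (- 1 / (q - 1)) * q" using q by (simp add: field_simps)
    show "(- 1 / (q - 1)) * ?X powr (- 1 / (q - 1) - 1) * ((q - 1) * b * (2 * y))
        = - (2 * b * y) * (?X powr (- 1 / (q - 1))) powr q"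
      unfolding exponent powr_powr using q by simp
  qed
qed

lemma q_kernel_powr_has_derivative:
  assumes "1 \<le> q" "0 < b"
  shows "((\<lambda>y. q_kernel q b y powr r) has_real_derivative
           - (2 * b * r * y) * q_kernel q b y powr (r + q - 1)) (at y)"
proof -
  note pos = q_kernel_pos[OF assms, of y]
  have "((\<lambda>y. q_kernel q b y powr r) has_real_derivative
      r * q_kernel q b y powr (r - 1) * (- (2 * b * y) * q_kernel q b y powr q)) (at y)"
    using pos by (auto intro!: derivative_eq_intros q_kernel_has_derivative assms)
  moreover have "q_kernel q b y powr (r + q - 1) = q_kernel q b y powr (r - 1) * q_kernel q b y powr q"
    by (simp flip: powr_add add: algebra_simps)
  ultimately show ?thesis by (simp add: mult_ac)
qed

section \<open>Decay and moments of the kernel\<close>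

lemma continuous_on_q_kernel_powr:
  assumes "1 \<le> q" "0 < b"
  shows "continuous_on A (\<lambda>y. q_kernel q b y powr r)"
  by (intro continuous_at_imp_continuous_on ballI DERIV_isCont[OF q_kernel_powr_has_derivative[OF assms]])

text \<open>For \<open>q > 1\<close> the kernel behaves like \<open>\<bar>y\<bar>\<^bsup>- 2 / (q - 1)\<^esup>\<close>, which explains the bound on \<open>k\<close>; multiplied
  out by \<open>q - 1\<close>, the bound also covers \<open>q = 1\<close>, where it imposes nothing on \<open>k\<close>.\<close>

lemma q_kernel_decay:
  assumes q: "1 \<le> q" and b: "0 < b" and r: "0 < r" and k: "real k * (q - 1) < 2 * r"
  shows "((\<lambda>y. y ^ k * q_kernel q b y powr r) \<longlongrightarrow> 0) at_infinity"
proof -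
  have "((\<lambda>x. x ^ k * q_kernel q b x powr r) \<longlongrightarrow> 0) at_top"
  proof (cases "q = 1")
    case True
    have "0 < b * r" using b r by simp
    then have "filterlim (\<lambda>x. (b * r) * x\<^sup>2) at_top at_top"
      by real_asymp
    from filterlim_compose[OF tendsto_power_div_exp_0 this, of k]
    have "((\<lambda>x. (1 / (b * r)) ^ k * (((b * r) * x\<^sup>2) ^ k / exp ((b * r) * x\<^sup>2))) \<longlongrightarrow> 0) at_top"
      by (intro tendsto_mult_right_zero)
    then show ?thesis
    proof (rule Lim_null_comparison[rotated])
      show "eventually (\<lambda>x. norm (x ^ k * q_kernel q b x powr r)
          \<le> (1 / (b * r)) ^ k * (((b * r) * x\<^sup>2) ^ k / exp ((b * r) * x\<^sup>2))) at_top"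
        using eventually_ge_at_top[of 1]
      proof eventually_elim
        case (elim x)
        (* Replacing x by its square turns the bound into a power over an exponential
           of the same quantity. *)
        have "x ^ k * exp (- (b * r * x\<^sup>2)) \<le> (x\<^sup>2) ^ k * exp (- (b * r * x\<^sup>2))"
          using elim by (intro mult_right_mono power_mono) (auto simp: power2_eq_square)
        also have "\<dots> = (1 / (b * r)) ^ k * (((b * r) * x\<^sup>2) ^ k / exp ((b * r) * x\<^sup>2))"
        proof -
          have "(1 / (b * r)) ^ k * ((b * r) * x\<^sup>2) ^ k = (x\<^sup>2) ^ k"
            unfolding power_mult_distrib[symmetric] using b r by simp
          then show ?thesis by (simp add: exp_minus divide_inverse flip: mult.assoc)
        qed
        finally show ?case
          using elim True by (simp add: q_kernel_1 powr_def mult_ac)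
      qed
    qed
  next
    case False
    then have q: "1 < q" using q by simp
    define c where "c = (q - 1) * b"
    define s where "s = r / (q - 1)"
    have c: "0 < c" using q b by (simp add: c_def)
    have s: "real k - 2 * s < 0" using q k by (simp add: s_def field_simps)
    have "((\<lambda>x. c powr (- s) * x powr (real k - 2 * s)) \<longlongrightarrow> 0) at_top"
      using s by (intro tendsto_mult_right_zero tendsto_neg_powr filterlim_ident)
    then show ?thesis
    proof (rule Lim_null_comparison[rotated])
      show "eventually (\<lambda>x. norm (x ^ k * q_kernel q b x powr r) \<le> c powr (- s) * x powr (real k - 2 * s)) at_top"
        using eventually_gt_at_top[of 0]
      proof eventually_elim
        case (elim x)
        have "q_kernel q b x powr r = (1 + c * x\<^sup>2) powr (- s)"
          using q b by (simp add: q_kernel_gt_1 powr_powr c_def s_def)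
        also have "\<dots> \<le> (c * x\<^sup>2) powr (- s)"
          using c elim r q by (intro powr_mono2') (auto simp: s_def)
        also have "\<dots> = c powr (- s) * x powr (- 2 * s)"
          using c elim by (simp add: powr_mult powr_powr flip: powr_numeral)
        finally have "x ^ k * q_kernel q b x powr r \<le> x ^ k * (c powr (- s) * x powr (- 2 * s))"
          using elim by (intro mult_left_mono) auto
        also have "\<dots> = c powr (- s) * x powr (real k - 2 * s)"
          using elim by (simp add: powr_diff powr_minus powr_realpow divide_inverse mult_ac)
        finally show ?case using elim by simp
      qed
    qed
  qed
  then have "((\<lambda>y. \<bar>y\<bar> ^ k * q_kernel q b \<bar>y\<bar> powr r) \<longlongrightarrow> 0) at_infinity"
    by (rule filterlim_compose) (auto simp: filterlim_at_top eventually_at_infinity)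
  moreover have "q_kernel q b \<bar>y\<bar> = q_kernel q b y" for y by (simp add: q_kernel_def)
  ultimately show ?thesis
    by (subst tendsto_rabs_zero_iff[symmetric]) (simp add: abs_mult power_abs)
qed

lemma integrable_q_kernel_moment:
  assumes "1 \<le> q" "0 < b" "0 < r" "real (k + 2) * (q - 1) < 2 * r"
  shows "integrable lborel (\<lambda>y. y ^ k * q_kernel q b y powr r)"
proof (rule integrable_if_square_decay)
  show "continuous_on UNIV (\<lambda>y. y ^ k * q_kernel q b y powr r)"
    by (intro continuous_intros continuous_on_q_kernel_powr assms)
  show "((\<lambda>y. y\<^sup>2 * (y ^ k * q_kernel q b y powr r)) \<longlongrightarrow> 0) at_infinity"
    using q_kernel_decay[OF assms] by (simp add: power_add power2_eq_square mult_ac)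
qed

text \<open>Integration by parts, in the form that the integral of the derivative of
  \<open>y\<^bsup>k + 1\<^esup> w\<^bsup>r - q + 1\<^esup>\<close> is zero. The condition on \<open>k\<close> makes the decay criterion applicable to the higher of
  the two moments.\<close>

lemma q_kernel_moment_recurrence:
  assumes q: "1 \<le> q" and b: "0 < b" and r: "0 < r"
    and k: "real (k + 4) * (q - 1) < 2 * r"
  shows "real (k + 1) * (\<integral>y. y ^ k * q_kernel q b y powr r \<partial>lborel)
       = b * (2 * (r - q + 1) - real (k + 1) * (q - 1)) *
         (\<integral>y. y ^ (k + 2) * q_kernel q b y powr r \<partial>lborel)"
proof -
  let ?w = "q_kernel q b"
  define A where "A = real (k + 1)"
  define B where "B = b * (2 * (r - q + 1) - real (k + 1) * (q - 1))"
  define f where "f = (\<lambda>y. A * (y ^ k * ?w y powr r) - B * (y ^ (k + 2) * ?w y powr r))"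
  have le: "real k * (q - 1) \<le> real (k + 2) * (q - 1)" "real (k + 2) * (q - 1) \<le> real (k + 4) * (q - 1)"
    using q by (auto intro: mult_right_mono)
  have int: "integrable lborel (\<lambda>y. y ^ k * ?w y powr r)"
      "integrable lborel (\<lambda>y. y ^ (k + 2) * ?w y powr r)"
    using le k integrable_q_kernel_moment[OF q b r, of k]
      integrable_q_kernel_moment[OF q b r, of "k + 2"]
    by (simp_all add: add.assoc del: add_2_eq_Suc')
  have k1: "real (k + 1) * (q - 1) < 2 * (r - q + 1)"
    using k q by (simp add: algebra_simps)
  have "0 \<le> real (k + 1) * (q - 1)" using q by simp
  then have "0 < 2 * (r - q + 1)" using k1 by (rule le_less_trans)
  then have p: "0 < r - q + 1" by simp
  have "(\<integral>y. f y \<partial>lborel) = 0"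
  proof (rule integral_derivative_eq_0)
    show "((\<lambda>y. y ^ (k + 1) * ?w y powr (r - q + 1)) \<longlongrightarrow> 0) at_infinity"
      by (rule q_kernel_decay[OF q b p k1])
    show "((\<lambda>y. y ^ (k + 1) * ?w y powr (r - q + 1)) has_real_derivative f y) (at y)" for y
    proof -
      have "((\<lambda>y. ?w y powr (r - q + 1)) has_real_derivative
          - (2 * b * (r - q + 1) * y) * ?w y powr r) (at y)"
        using q_kernel_powr_has_derivative[OF q b, of "r - q + 1" y] by simp
      from DERIV_mult[OF DERIV_pow[of "k + 1"] this]
      show ?thesis
      proof (rule DERIV_cong)
        have "a * P * (W * (1 + (q - 1) * b * y\<^sup>2)) + - (2 * b * (r - q + 1) * y) * W * (P * y)
            = a * (P * W) - b * (2 * (r - q + 1) - a * (q - 1)) * (P * y\<^sup>2 * W)" for a P W :: real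
          by (simp add: algebra_simps power2_eq_square)
        then show "real (k + 1) * y ^ (k + 1 - Suc 0) * ?w y powr (r - q + 1)
            + - (2 * b * (r - q + 1) * y) * ?w y powr r * y ^ (k + 1) = f y"
          by (simp only: f_def A_def B_def q_kernel_powr_shift[OF q b] power_add power_one_right
              add_diff_cancel_right' One_nat_def[symmetric])
      qed
    qed
    show "continuous_on UNIV f"
      unfolding f_def by (intro continuous_intros continuous_on_q_kernel_powr q b)
    show "integrable lborel f"
      unfolding f_def using int by auto
  qed
  then show ?thesis
    unfolding f_def using int by (simp add: A_def B_def)
qed

lemma q_kernel_mass_pos:
  assumes "1 \<le> q" "0 < b" "0 < r" "2 * (q - 1) < 2 * r"
  shows "0 < (\<integral>y. q_kernel q b y powr r \<partial>lborel)"
proof -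
  have int: "integrable lborel (\<lambda>y. q_kernel q b y powr r)"
    using integrable_q_kernel_moment[of q b r 0] assms by simp
  have "(\<integral>y. q_kernel q b y powr r \<partial>lborel) \<noteq> 0"
  proof
    assume "(\<integral>y. q_kernel q b y powr r \<partial>lborel) = 0"
    then have "AE y in lborel. q_kernel q b y powr r = 0"
      using int by (subst (asm) integral_nonneg_eq_0_iff_AE) auto
    then have "AE y in (lborel :: real measure). False"
      by eventually_elim (use q_kernel_pos[OF assms(1,2)] in \<open>auto simp: less_le\<close>)
    then show False by (simp add: AE_iff_measurable[OF _ refl])
  qed
  moreover have "0 \<le> (\<integral>y. q_kernel q b y powr r \<partial>lborel)"
    by (intro Bochner_Integration.integral_nonneg) auto
  ultimately show ?thesis by linarith
qed

section \<open>Escort moments of the q-Gaussian distribution\<close>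

text \<open>Division by zero yields zero, so with \<open>C\<^sub>q = 0\<close> the density would vanish identically, contrary to
  its having total mass one. Thus the normalising integral need not be computed.\<close>

lemma std_q_gaussian_norm_const_nonzero:
  assumes "prob_space M" "std_q_gaussian q M Y"
  shows "q_norm_const q \<noteq> 0"
proof
  assume 0: "q_norm_const q = 0"
  interpret prob_space M by fact
  have D: "distributed M lborel Y (\<lambda>y. ennreal (q_gaussian_density q y))"
    using assms by (simp add: std_q_gaussian_def)
  have "prob_space (density lborel (\<lambda>y. ennreal (q_gaussian_density q y)))"
    using prob_space_distr[OF distributed_measurable[OF D]] distributed_distr_eq_density[OF D] by simp
  then have "emeasure (density lborel (\<lambda>y::real. 0)) UNIV = 1"
    using 0 prob_space.emeasure_space_1 by (fastforce simp: q_gaussian_density_def)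
  then show False by (simp add: emeasure_density)
qed

lemma std_q_gaussian_rv_density_AE:
  assumes "prob_space M" "std_q_gaussian q M Y" "1 \<le> q" "q < 3"
  shows "\<exists>K>0. AE y in lborel. rv_density M Y y = K * q_kernel q (q_beta q) y"
proof -
  interpret prob_space M by fact
  have D: "distributed M lborel Y (\<lambda>y. ennreal (q_gaussian_density q y))"
    using assms by (simp add: std_q_gaussian_def)
  have b: "0 < q_beta q" using assms by (simp add: q_beta_def)
  define K where "K = sqrt (q_beta q) / q_norm_const q"
  have "0 \<le> q_norm_const q"
    unfolding q_norm_const_def by (intro Bochner_Integration.integral_nonneg) (auto simp: q_exp_def)
  then have K: "0 < K"
    using std_q_gaussian_norm_const_nonzero[OF assms(1,2)] b by (simp add: K_def)
  have "AE y in lborel. RN_deriv lborel (distr M lborel Y) y = ennreal (q_gaussian_density q y)"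
    using distributed_RN_deriv[OF D] by (simp add: distributed_distr_eq_density[OF D])
  then have "AE y in lborel. rv_density M Y y = K * q_kernel q (q_beta q) y"
  proof eventually_elim
    case (elim y)
    have "q_gaussian_density q y = K * q_kernel q (q_beta q) y"
      by (simp add: q_gaussian_density_def K_def q_kernel_def)
    then show ?case
      using elim K q_kernel_pos[OF assms(3) b, of y] by (simp add: rv_density_def)
  qed
  with K show ?thesis by blast
qed

text \<open>Both the numerator and the normalising integral scale by \<open>K\<^sup>r\<close>.\<close>

lemma escort_moment_std_q_gaussian:
  assumes "prob_space M" "std_q_gaussian q M Y" "1 \<le> q" "q < 3"
  shows "escort_moment r n M Y =
    (\<integral>y. y ^ n * q_kernel q (q_beta q) y powr r \<partial>lborel)
      / (\<integral>y. q_kernel q (q_beta q) y powr r \<partial>lborel)"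
proof -
  let ?w = "q_kernel q (q_beta q)"
  obtain K where K: "0 < K" and AE: "AE y in lborel. rv_density M Y y = K * ?w y"
    using std_q_gaussian_rv_density_AE[OF assms] by blast
  have b: "0 < q_beta q" using assms by (simp add: q_beta_def)
  have pow: "AE y in lborel. rv_density M Y y powr r = K powr r * ?w y powr r"
    using AE by eventually_elim (use K in \<open>simp add: powr_mult less_imp_le[OF q_kernel_pos[OF assms(3) b]]\<close>)
  have [measurable]: "rv_density M Y \<in> borel_measurable borel"
    unfolding rv_density_def[abs_def] by measurable
  have [measurable]: "(\<lambda>y. ?w y powr r) \<in> borel_measurable borel"
    by (intro borel_measurable_continuous_onI continuous_on_q_kernel_powr assms b)
  have nu: "nu r (rv_density M Y) = K powr r * (\<integral>y. ?w y powr r \<partial>lborel)"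
    unfolding nu_def by (subst integral_cong_AE[OF _ _ pow]) auto
  have "escort_moment r n M Y =
      (\<integral>y. (K powr r / nu r (rv_density M Y)) * (y ^ n * ?w y powr r) \<partial>lborel)"
    unfolding escort_moment_def
  proof (intro integral_cong_AE)
    show "AE y in lborel. y ^ n * (rv_density M Y y powr r / nu r (rv_density M Y))
        = K powr r / nu r (rv_density M Y) * (y ^ n * ?w y powr r)"
      using pow by eventually_elim simp
  qed auto
  then show ?thesis using K by (simp add: nu)
qed

lemma normalized_second_moment_std_q_gaussian:
  assumes "prob_space M" "std_q_gaussian q M Y" "1 \<le> q" "q < 3"
  shows "normalized_second_moment q M Y = 1 / (q_beta q * (q + 1))"
proof -
  define b where "b = q_beta q"
  have b: "0 < b" using assms by (simp add: q_beta_def b_def)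
  define J where "J n = (\<integral>y. y ^ n * q_kernel q b y powr (2 * q - 1) \<partial>lborel)" for n
  have pos: "0 < J 0"
    using q_kernel_mass_pos[of q b "2 * q - 1"] assms(3) b by (simp add: J_def)
  have "real (0 + 1) * J 0
      = b * (2 * (2 * q - 1 - q + 1) - real (0 + 1) * (q - 1)) * J (0 + 2)"
    unfolding J_def by (rule q_kernel_moment_recurrence) (use assms(3) b in auto)
  then have "J 0 = b * (q + 1) * J 2"
    by (simp add: algebra_simps flip: numeral_2_eq_2)
  with pos have "J 2 / J 0 = 1 / (b * (q + 1))"
    using b assms(3) by (auto simp: divide_simps)
  then show ?thesis
    unfolding normalized_second_moment_def escort_moment_std_q_gaussian[OF assms]
    by (simp add: J_def b_def)
qed

lemma normalized_fourth_moment_std_q_gaussian: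
  assumes "prob_space M" "std_q_gaussian q M Y" "1 \<le> q" "q < 3"
  shows "normalized_fourth_moment q M Y = 3 / ((q_beta q)\<^sup>2 * ((5 * q - 3) * (3 * q - 1)))"
proof -
  define b where "b = q_beta q"
  have b: "0 < b" using assms by (simp add: q_beta_def b_def)
  define J where "J n = (\<integral>y. y ^ n * q_kernel q b y powr (4 * q - 3) \<partial>lborel)" for n
  have pos: "0 < J 0"
    using q_kernel_mass_pos[of q b "4 * q - 3"] assms(3) b by (simp add: J_def)
  have rec: "real (k + 1) * J k
      = b * (2 * (4 * q - 3 - q + 1) - real (k + 1) * (q - 1)) * J (k + 2)" if "k \<le> 2" for k
    unfolding J_def
  proof (rule q_kernel_moment_recurrence)
    have "real (k + 4) * (q - 1) \<le> 6 * (q - 1)"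
      using that assms(3) by (intro mult_right_mono) auto
    then show "real (k + 4) * (q - 1) < 2 * (4 * q - 3)" using assms(3) by simp
  qed (use assms(3) b in auto)
  have 0: "J 0 = b * (5 * q - 3) * J 2"
    using rec[of 0] by (simp add: algebra_simps flip: numeral_2_eq_2)
  have 2: "3 * J 2 = b * (3 * q - 1) * J 4"
    using rec[of 2] by (simp add: algebra_simps)
  have eq: "3 * J 0 = (b\<^sup>2 * ((5 * q - 3) * (3 * q - 1))) * J 4"
  proof -
    have "3 * J 0 = b * (5 * q - 3) * (3 * J 2)" using 0 by simp
    then show ?thesis unfolding 2 by (simp add: power2_eq_square mult_ac)
  qed
  have "b\<^sup>2 * ((5 * q - 3) * (3 * q - 1)) \<noteq> 0" using b assms(3) by simp
  then have "J 4 / J 0 = 3 / (b\<^sup>2 * ((5 * q - 3) * (3 * q - 1)))"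
    using eq pos by (simp add: frac_eq_eq mult_ac)
  then show ?thesis
    unfolding normalized_fourth_moment_def escort_moment_std_q_gaussian[OF assms]
    by (simp add: J_def b_def)
qed

section \<open>The normalized kurtosis\<close>

theorem theorem5p6:
  fixes q :: real and M :: "'a measure" and Y :: "'a \<Rightarrow> real"
  assumes "1 \<le> q" and "q < 3"
    and "prob_space M"
    and "std_q_gaussian q M Y"
  shows "normalized_kurtosis q M Y = 3 * (q + 1)\<^sup>2 / ((5 * q - 3) * (3 * q - 1))"
proof -
  have "q_beta q \<noteq> 0" using assms by (simp add: q_beta_def)
  then show ?thesis
    unfolding normalized_kurtosis_def
      normalized_second_moment_std_q_gaussian[OF assms(3,4,1,2)]
      normalized_fourth_moment_std_q_gaussian[OF assms(3,4,1,2)]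
    by (simp add: power_divide power_mult_distrib)
qed

end
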